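(* Let $\mathsf H_{21}$ be the 21-vertex, 14-hyperedge hypergraph defined in the context. Let $$p=\frac{\sqrt{14}+\sqrt2}{4},\qquad q=\frac{\sqrt{14}-\sqrt2}{4}.$$ Assign to the vertices of $\mathsf H_{21}$ the following vectors in $\mathbb C^3$ (denoted by the same symbols as the vertices): $$c=(0,0,1),\quad a_1=(1,1,0),\quad a_2=(1,-1,0),\quad b_1=(1,\mathrm i,0),\quad b_2=(1,-\mathrm i,0),$$ \begin{align*} v_0&=(1,-1,\sqrt2),& v_4&=(1,-1,-\sqrt2),\\ v_1&=(1,\mathrm i,p+\mathrm iq),& v_5&=(1,\mathrm i,-p-\mathrm iq),\\ v_2&=(1,1,-\mathrm i\sqrt2),& v_6&=(1,1,\mathrm i\sqrt2),\\ v_3&=(1,-\mathrm i,q-\mathrm ip),& v_7&=(1,-\mathrm i,-q+\mathrm ip), \end{align*} \begin{align*} v_{01}&=(-p+\mathrm i(q+\sqrt2),\ \sqrt2-p+\mathrm iq,\ 1-\mathrm i),\\ v_{12}&=(\sqrt2-p+\mathrm iq,\ p-\mathrm i(q+\sqrt2),\ 1+\mathrm i),\\ v_{23}&=(q+\sqrt2+\mathrm ip,\ -q+\mathrm i(\sqrt2-p),\ -1+\mathrm i),\\ v_{34}&=(q+\mathrm i(p-\sqrt2),\ q+\sqrt2+\mathrm ip,\ -1-\mathrm i),\\ v_{45}&=(p-\mathrm i(q+\sqrt2),\ -\sqrt2+p-\mathrm iq,\ 1-\mathrm i),\\ v_{56}&=(-\sqrt2+p-\mathrm iq,\ -p+\mathrm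 i(q+\sqrt2),\ 1+\mathrm i),\\ v_{67}&=(-q-\sqrt2-\mathrm ip,\ q-\mathrm i(\sqrt2-p),\ -1+\mathrm i),\\ v_{70}&=(-q-\mathrm i(p-\sqrt2),\ -q-\sqrt2-\mathrm ip,\ -1-\mathrm i). \end{align*} Then this assignment is a faithful orthogonal representation of $\mathsf H_{21}$ in $\mathbb C^3$.
   Context: Inner product: $\langle x,y\rangle=\sum_{k}\overline{x_k}\,y_k$. Faithful orthogonal representation: let $\mathsf H=(V,\mathcal E)$ be a three-uniform hypergraph, $\mathbb F\in\{\mathbb R,\mathbb C\}$ and $d\ge 3$. A faithful orthogonal representation of $\mathsf H$ in $\mathbb F^d$ assigns to every $v\in V$ a nonzero vector $x_v\in\mathbb F^d$ such that (1) distinct vertices determine distinct rays (one-dimensional subspaces), and (2) for distinct $u,v\in V$, $\langle x_u,x_v\rangle=0$ if and only if $u$ and $v$ belong to a common hyperedge. The hypergraph $\mathsf H_{21}$: it has 21 vertices, namely $v_0,\ldots,v_7$ (midpoints), $v_{01},v_{12},v_{23},v_{34},v_{45},v_{56},v_{67},v_{70}$ (corners; also written $v_{j,j+1}$ with indices modulo $8$), $a_1,a_2,b_1,b_2$, and $c$. It has 14 hyperedges: $E_j=\{v_{j-1,j},\,v_j,\,v_{j,j+1}\}$ for $j=0,\ldots,7$ (indices modulo $8$); $D_0=\{v_0,a_1,v_4\}$, $D_2=\{v_2,a_2,v_6\}$, $D_1=\{v_1,b_2,v_5\}$, $D_3=\{v_3,b_1,v_7\}$; $F_a=\{a_1,c,a_2\}$,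 $F_b=\{b_1,c,b_2\}$. *)

theory Defs
  imports "HOL-Analysis.Analysis"
begin

text \<open>
  The inner product that HOL-Analysis provides on \<^typ>\<open>complex^'n\<close> is the real-valued one,
  so the Hermitian form (conjugate-linear in the first argument) is introduced here.
\<close>

definition hermitian_inner :: "complex^'n \<Rightarrow> complex^'n \<Rightarrow> complex" where
  "hermitian_inner x y = (\<Sum>k\<in>UNIV. cnj (x $ k) * y $ k)"

record 'v hypergraph =
  vertices :: "'v set"
  hyperedges :: "'v set set"

definition three_uniform :: "'v hypergraph \<Rightarrow> bool" where
  "three_uniform H \<longleftrightarrow> (\<forall>e\<in>hyperedges H. e \<subseteq> vertices H \<and> card e = 3)"

text \<open>
  Representations over the complex field. Rays are complex one-dimensional subspaces:
  \<^term>\<open>vec.span\<close> is the span with respect to scalar multiplication by \<^typ>\<open>complex\<close>,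
  whereas plain \<^term>\<open>span\<close> would be the real span.
\<close>

definition faithful_orthogonal_representation ::
    "'v hypergraph \<Rightarrow> ('v \<Rightarrow> complex^'n) \<Rightarrow> bool" where
  "faithful_orthogonal_representation H x \<longleftrightarrow>
     three_uniform H \<and> CARD('n) \<ge> 3 \<and>
     (\<forall>v\<in>vertices H. x v \<noteq> 0) \<and>
     (\<forall>u\<in>vertices H. \<forall>v\<in>vertices H. u \<noteq> v \<longrightarrow> vec.span {x u} \<noteq> vec.span {x v}) \<and>
     (\<forall>u\<in>vertices H. \<forall>v\<in>vertices H. u \<noteq> v \<longrightarrow>
        (hermitian_inner (x u) (x v) = 0 \<longleftrightarrow> (\<exists>e\<in>hyperedges H. u \<in> e \<and> v \<in> e)))"

datatype vertex21 =
    V0 | V1 | V2 | V3 | V4 | V5 | V6 | V7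
  | V01 | V12 | V23 | V34 | V45 | V56 | V67 | V70
  | A1 | A2 | B1 | B2 | C

definition H21 :: "vertex21 hypergraph" where
  "H21 = \<lparr> vertices = UNIV,
           hyperedges =
             {{V70, V0, V01}, {V01, V1, V12}, {V12, V2, V23}, {V23, V3, V34},
              {V34, V4, V45}, {V45, V5, V56}, {V56, V6, V67}, {V67, V7, V70},
              {V0, A1, V4}, {V2, A2, V6}, {V1, B2, V5}, {V3, B1, V7},
              {A1, C, A2}, {B1, C, B2}} \<rparr>"

lemma UNIV_vertex21:
  "UNIV = {V0, V1, V2, V3, V4, V5, V6, V7, V01, V12, V23, V34, V45, V56, V67, V70,
           A1, A2, B1, B2, C}"
proof -
  have "v \<in> {V0, V1, V2, V3, V4, V5, V6, V7, V01, V12, V23, V34, V45, V56, V67, V70,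
             A1, A2, B1, B2, C}" for v
    by (cases v) simp_all
  then show ?thesis by blast
qed

lemma card_vertices_H21: "card (vertices H21) = 21"
  by (simp add: H21_def UNIV_vertex21)

lemma card_hyperedges_H21: "card (hyperedges H21) = 14"
  by (simp add: H21_def insert_eq_iff doubleton_eq_iff set_eq_subset)

definition p21 :: real where "p21 = (sqrt 14 + sqrt 2) / 4"

definition q21 :: real where "q21 = (sqrt 14 - sqrt 2) / 4"

primrec rep21 :: "vertex21 \<Rightarrow> complex^3" where
  "rep21 C = vector [0, 0, 1]"
| "rep21 A1 = vector [1, 1, 0]"
| "rep21 A2 = vector [1, -1, 0]"
| "rep21 B1 = vector [1, \<i>, 0]"
| "rep21 B2 = vector [1, -\<i>, 0]"
| "rep21 V0 = vector [1, -1, sqrt 2]"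
| "rep21 V4 = vector [1, -1, - sqrt 2]"
| "rep21 V1 = vector [1, \<i>, p21 + \<i> * q21]"
| "rep21 V5 = vector [1, \<i>, - p21 - \<i> * q21]"
| "rep21 V2 = vector [1, 1, - \<i> * sqrt 2]"
| "rep21 V6 = vector [1, 1, \<i> * sqrt 2]"
| "rep21 V3 = vector [1, -\<i>, q21 - \<i> * p21]"
| "rep21 V7 = vector [1, -\<i>, - q21 + \<i> * p21]"
| "rep21 V01 = vector [- p21 + \<i> * (q21 + sqrt 2), sqrt 2 - p21 + \<i> * q21, 1 - \<i>]"
| "rep21 V12 = vector [sqrt 2 - p21 + \<i> * q21, p21 - \<i> * (q21 + sqrt 2), 1 + \<i>]"
| "rep21 V23 = vector [q21 + sqrt 2 + \<i> * p21, - q21 + \<i> * (sqrt 2 - p21), -1 + \<i>]"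
| "rep21 V34 = vector [q21 + \<i> * (p21 - sqrt 2), q21 + sqrt 2 + \<i> * p21, -1 - \<i>]"
| "rep21 V45 = vector [p21 - \<i> * (q21 + sqrt 2), - sqrt 2 + p21 - \<i> * q21, 1 - \<i>]"
| "rep21 V56 = vector [- sqrt 2 + p21 - \<i> * q21, - p21 + \<i> * (q21 + sqrt 2), 1 + \<i>]"
| "rep21 V67 = vector [- q21 - sqrt 2 - \<i> * p21, q21 - \<i> * (sqrt 2 - p21), -1 + \<i>]"
| "rep21 V70 = vector [- q21 - \<i> * (p21 - sqrt 2), - q21 - sqrt 2 - \<i> * p21, -1 - \<i>]"

end

theory Submission
  imports Defs
begin

text \<open>
  Vectors spanning the same ray are orthogonal to the same vectors. So once orthogonality is known to
  match adjacency, two adjacent vertices cannot share a ray (a nonzero vector is not orthogonal to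
  itself), and neither can two non-adjacent ones, since some vertex is adjacent to exactly one of them.
  Only the orthogonality relations need computation. Because
  \<open>\<surd>2 = 2 (p - q)\<close>, \<open>p q = 3/4\<close> and \<open>p\<^sup>2 + q\<^sup>2 = 2\<close>, every inner product has real and imaginary parts
  that are rational linear combinations of \<open>1, p, q, p\<^sup>2\<close>; they vanish identically for adjacent
  vertices, and coarse rational bounds on \<open>p, q, p\<^sup>2\<close> rule out vanishing for the others.
\<close>

lemma hermitian_inner_vector_3:
  "hermitian_inner (vector [a, b, c] :: complex^3) (vector [a', b', c']) =
     cnj a * a' + cnj b * b' + cnj c * c'"
  by (simp add: hermitian_inner_def sum_3)

lemma hermitian_inner_scale_left:
  "hermitian_inner (k *s x) y = cnj k * hermitian_inner x y"
  by (simp add: hermitian_inner_def sum_distrib_left mult.assoc)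

lemma hermitian_inner_self_eq_0_iff: "hermitian_inner x x = 0 \<longleftrightarrow> x = 0"
proof -
  have "hermitian_inner x x = of_real (\<Sum>k\<in>UNIV. (norm (x $ k))\<^sup>2)"
    unfolding hermitian_inner_def of_real_sum
    by (intro sum.cong refl) (metis complex_norm_square mult.commute)
  then have "hermitian_inner x x = 0 \<longleftrightarrow> (\<Sum>k\<in>UNIV. (norm (x $ k))\<^sup>2) = 0"
    by (metis of_real_eq_0_iff)
  then show ?thesis
    by (simp add: sum_nonneg_eq_0_iff vec_eq_iff)
qed

text \<open>Each vector is a scalar multiple of the other, so vanishing passes both ways without
  inverting a scalar.\<close>

lemma hermitian_inner_eq_0_iff_of_span_eq:
  assumes "vec.span {x} = vec.span {x'}"
  shows "hermitian_inner x y = 0 \<longleftrightarrow> hermitian_inner x' y = 0"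
proof -
  have "x \<in> vec.span {x'}" "x' \<in> vec.span {x}"
    using assms vec.span_base[of x "{x}"] vec.span_base[of x' "{x'}"] by auto
  then obtain k l where "x = k *s x'" "x' = l *s x"
    unfolding vec.span_singleton by blast
  then show ?thesis
    by (metis hermitian_inner_scale_left mult_zero_right)
qed

definition adjacent :: "'v hypergraph \<Rightarrow> 'v \<Rightarrow> 'v \<Rightarrow> bool" where
  "adjacent H u v \<longleftrightarrow> (\<exists>e\<in>hyperedges H. u \<in> e \<and> v \<in> e)"

text \<open>Since \<open>orth\<close> relates only distinct vertices, a separating \<open>w\<close>
  has to differ from both \<open>u\<close> and \<open>v\<close> before adjacency can be turned into
  orthogonality.\<close>

lemma faithful_orthogonal_representationI:
  fixes x :: "'v \<Rightarrow> complex^'n"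
  assumes "three_uniform H" "CARD('n) \<ge> 3"
    and nonzero: "\<And>v. v \<in> vertices H \<Longrightarrow> x v \<noteq> 0"
    and orth: "\<And>u v. u \<in> vertices H \<Longrightarrow> v \<in> vertices H \<Longrightarrow> u \<noteq> v \<Longrightarrow>
          hermitian_inner (x u) (x v) = 0 \<longleftrightarrow> adjacent H u v"
    and separated: "\<And>u v. u \<in> vertices H \<Longrightarrow> v \<in> vertices H \<Longrightarrow> u \<noteq> v \<Longrightarrow> \<not> adjacent H u v \<Longrightarrow>
          \<exists>w\<in>vertices H. w \<noteq> u \<and> w \<noteq> v \<and> adjacent H u w \<noteq> adjacent H v w"
  shows "faithful_orthogonal_representation H x"
proof -
  have "vec.span {x u} \<noteq> vec.span {x v}"
    if uv: "u \<in> vertices H" "v \<in> vertices H" "u \<noteq> v" for u v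
  proof
    assume eq: "vec.span {x u} = vec.span {x v}"
    show False
    proof (cases "adjacent H u v")
      case True
      then have "hermitian_inner (x v) (x v) = 0"
        using orth[OF uv] hermitian_inner_eq_0_iff_of_span_eq[OF eq] by blast
      then show False
        using nonzero[OF uv(2)] by (simp add: hermitian_inner_self_eq_0_iff)
    next
      case False
      then show False
        using separated[OF uv] orth uv hermitian_inner_eq_0_iff_of_span_eq[OF eq] by metis
    qed
  qed
  then show ?thesis
    using assms(1,2) nonzero orth
    by (simp add: faithful_orthogonal_representation_def flip: adjacent_def)
qed

lemma sqrt2_p21_q21: "sqrt 2 = 2 * p21 - 2 * q21"
  by (simp add: p21_def q21_def field_simps)

lemma p21_mult_q21: "p21 * q21 = 3 / 4" "q21 * p21 = 3 / 4"
  by (simp_all add: p21_def q21_def algebra_simps)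

lemma q21_square: "q21 * q21 = 2 - p21 * p21"
  by (simp add: p21_def q21_def field_simps)

text \<open>Right-nested products hide the pairs of factors that \<open>p21_mult_q21\<close> and
  \<open>q21_square\<close> match; these variants reduce them inside longer products.\<close>

lemma p21_q21_mult_left:
  "p21 * (q21 * x) = 3 / 4 * x" "q21 * (p21 * x) = 3 / 4 * x"
  "q21 * (q21 * x) = 2 * x - p21 * (p21 * x)"
  by (simp_all add: p21_mult_q21 q21_square left_diff_distrib flip: mult.assoc)

lemma p21_q21_bounds:
  "128 / 100 < p21" "p21 < 129 / 100" "58 / 100 < q21" "q21 < 59 / 100"
  "166 / 100 < p21 * p21" "p21 * p21 < 167 / 100"
proof -
  have sqrt_bounds:
    "3.74 < sqrt 14" "sqrt 14 < 3.742" "1.41 < sqrt 2" "sqrt 2 < 1.415"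
    "2.64 < sqrt 7" "sqrt 7 < 2.65"
    by (rule real_less_rsqrt real_less_lsqrt; simp add: power2_eq_square)+
  then show "128 / 100 < p21" "p21 < 129 / 100" "58 / 100 < q21" "q21 < 59 / 100"
    by (simp_all add: p21_def q21_def)
  \<comment> \<open>The square is \<open>(16 + 2 * sqrt 28) / 16\<close> with
    \<open>sqrt 28 = 2 * sqrt 7\<close>, hence the bounds on \<open>sqrt 7\<close> above.\<close>
  have "p21 * p21 = 1 + sqrt 7 / 4"
    using real_sqrt_mult[of 2 7] by (simp add: p21_def algebra_simps flip: mult.assoc)
  with sqrt_bounds show "166 / 100 < p21 * p21" "p21 * p21 < 167 / 100"
    by simp_all
qed

text \<open>Adjacency as a table that simp can evaluate. Every vertex lies in exactly two
  hyperedges, which meet only there, so it has four neighbours.\<close>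

primrec nbrs :: "vertex21 \<Rightarrow> vertex21 set" where
  "nbrs V0 = {V70, V01, A1, V4}"
| "nbrs V1 = {V01, V12, B2, V5}"
| "nbrs V2 = {V12, V23, A2, V6}"
| "nbrs V3 = {V23, V34, B1, V7}"
| "nbrs V4 = {V34, V45, A1, V0}"
| "nbrs V5 = {V45, V56, B2, V1}"
| "nbrs V6 = {V56, V67, A2, V2}"
| "nbrs V7 = {V67, V70, B1, V3}"
| "nbrs V01 = {V70, V0, V1, V12}"
| "nbrs V12 = {V01, V1, V2, V23}"
| "nbrs V23 = {V12, V2, V3, V34}"
| "nbrs V34 = {V23, V3, V4, V45}"
| "nbrs V45 = {V34, V4, V5, V56}"
| "nbrs V56 = {V45, V5, V6, V67}"
| "nbrs V67 = {V56, V6, V7, V70}"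
| "nbrs V70 = {V67, V7, V0, V01}"
| "nbrs A1 = {V0, V4, C, A2}"
| "nbrs A2 = {V2, V6, C, A1}"
| "nbrs B1 = {V3, V7, C, B2}"
| "nbrs B2 = {V1, V5, C, B1}"
| "nbrs C = {A1, A2, B1, B2}"

lemma adjacent_H21: "u \<noteq> v \<Longrightarrow> adjacent H21 u v \<longleftrightarrow> v \<in> nbrs u"
  by (cases u) (auto simp: adjacent_def H21_def)

lemma three_uniform_H21: "three_uniform H21"
  by (simp add: three_uniform_def H21_def)

lemma separated_H21:
  assumes "u \<noteq> v" "v \<notin> nbrs u"
  shows "\<exists>w. w \<noteq> u \<and> w \<noteq> v \<and> (w \<in> nbrs u) \<noteq> (w \<in> nbrs v)"
proof -
  \<comment> \<open>The witness can always be taken on the side of \<open>u\<close>: all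
    neighbourhoods have four elements, so distinct ones are never nested.\<close>
  have "\<exists>w\<in>nbrs u. w \<noteq> v \<and> w \<notin> nbrs v"
    using assms by (cases u; cases v; simp)
  moreover have "u \<notin> nbrs u" by (cases u) simp_all
  ultimately show ?thesis by metis
qed

lemma rep21_nonzero: "rep21 v \<noteq> 0"
  by (cases v) (simp_all add: vec_eq_iff forall_3 complex_eq_iff)

lemma hermitian_inner_rep21_eq_0_iff:
  assumes "u \<noteq> v"
  shows "hermitian_inner (rep21 u) (rep21 v) = 0 \<longleftrightarrow> v \<in> nbrs u"
  using assms
  \<comment> \<open>\<open>complex_eq_iff\<close> splits each product into real and imaginary parts.
    In the last stage \<open>p21 * p21\<close> acts as a third unknown beside \<open>p21\<close> and
    \<open>q21\<close>, which makes the refutations linear.\<close>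
  by (cases u; cases v;
      simp add: hermitian_inner_vector_3 complex_eq_iff sqrt2_p21_q21;
      (simp add: algebra_simps p21_mult_q21 q21_square p21_q21_mult_left)?;
      (intro conjI impI notI, (use p21_q21_bounds in linarith)+)?)

theorem theorem6:
  shows "faithful_orthogonal_representation H21 rep21"
proof (rule faithful_orthogonal_representationI)
  show "hermitian_inner (rep21 u) (rep21 v) = 0 \<longleftrightarrow> adjacent H21 u v" if "u \<noteq> v" for u v
    using that by (simp add: hermitian_inner_rep21_eq_0_iff adjacent_H21)
  show "\<exists>w\<in>vertices H21. w \<noteq> u \<and> w \<noteq> v \<and> adjacent H21 u w \<noteq> adjacent H21 v w"
    if uv: "u \<noteq> v" "\<not> adjacent H21 u v" for u v
  proof -
    obtain w where "w \<noteq> u" "w \<noteq> v" "(w \<in> nbrs u) \<noteq> (w \<in> nbrs v)"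
      using separated_H21[of u v] uv adjacent_H21 by blast
    then have "w \<in> vertices H21" "adjacent H21 u w \<noteq> adjacent H21 v w"
      using adjacent_H21[of u w] adjacent_H21[of v w] by (simp_all add: H21_def)
    with \<open>w \<noteq> u\<close> \<open>w \<noteq> v\<close> show ?thesis by blast
  qed
qed (simp_all add: three_uniform_H21 rep21_nonzero)

end
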